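(* Let $\lambda,\mu,\nu>0$, let $K$ be a positive integer and let $0<M\le K$. For the charging-station Markov process with $K'\in\{1,2,\dots\}\cup\{\infty\}$ parking spaces and power capacity $M'>0$ (the "system $(K',M')$", defined in the context, with the same rates $\lambda,\mu,\nu$ for all systems), let $C^{K'}_{M'}(\infty)$ and $Q^{K'}_{M'}(\infty)$ denote the number of fully charged EVs and the total number of EVs, respectively, in stationarity. Then $$\frac{\mathbb{E}[C^{\infty}_M(\infty)]}{\mathbb{E}[Q^{\infty}_M(\infty)]}\;\le\;\frac{\mathbb{E}[C^{K}_M(\infty)]}{\mathbb{E}[Q^{K}_M(\infty)]}\;\le\;\frac{\mathbb{E}[C^{K}_K(\infty)]}{\mathbb{E}[Q^{K}_M(\infty)]}.$$
   Context: Model (system $(K',M')$): a charging station has $K'$ parking spaces (possibly $K'=\infty$), each with an EV charger. Electric vehicles (EVs) arrive according to a Poisson process of rate $\lambda$; each EV has an exponential parking time with rate $\mu$ and an exponential charging requirement with rate $\nu$; interarrival times, parking times and charging requirements are mutually independent. An EV leaves when its parking time expires, whether or not it is fully charged; a fully charged EV stays until its parking time expires. An EV that arrives when all spaces are occupied leaves immediately (is lost). $Q(t)$ is the total number of EVs present at time $t$, $U(t)$ is the number of EVs present that are not fully charged, and $C(t)=Q(t)-U(t)$ is the number of fully charged EVs. The power consumed when there are $u$ uncharged EVs is $f(u)=\min\{u,M'\}$, and it is shared equally among the uncharged EVs. Thus $(U(t),Q(t))$ is a continuous-time Markov chain on $\{(u,q)\in\mathbb{Z}^2: 0\le u\le q\le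 K'\}$ (with $q<\infty$) with transition rates: - $(u,q)\to(u+1,q+1)$ at rate $\lambda$ if $q<K'$; - $(u,q)\to(u-1,q)$ at rate $\nu\min\{u,M'\}$; - $(u,q)\to(u-1,q-1)$ at rate $\mu u$; - $(u,q)\to(u,q-1)$ at rate $\mu(q-u)$. The argument $(\infty)$ denotes a random variable with the stationary distribution of the chain, $C(\infty)=Q(\infty)-U(\infty)$. $\mathbb{E}$ denotes expectation. *)

theory Defs
  imports "HOL-Probability.Probability"
begin

text \<open>
  \<open>ctmc_semigroup S r P\<close>: the kernels \<open>P t x\<close>, \<open>t \<ge> 0\<close>, are the transition probabilities of a
  continuous-time Markov chain on \<open>S\<close> that jumps from \<open>x\<close> to \<open>y \<noteq> x\<close> at rate \<open>r x y\<close>; the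
  derivative at time 0 of \<open>P t x\<close> at \<open>x\<close> itself is minus the total exit rate. Taking values in
  \<open>pmf\<close> makes the semigroup conservative (no loss of mass by explosion). Nothing is required of
  \<open>P\<close> at negative times or outside \<open>S\<close>.
\<close>
definition ctmc_semigroup ::
  "'s set \<Rightarrow> ('s \<Rightarrow> 's \<Rightarrow> real) \<Rightarrow> (real \<Rightarrow> 's \<Rightarrow> 's pmf) \<Rightarrow> bool" where
  "ctmc_semigroup S r P \<longleftrightarrow>
     (\<forall>x\<in>S. P 0 x = return_pmf x) \<and>
     (\<forall>x\<in>S. \<forall>t\<ge>0. set_pmf (P t x) \<subseteq> S) \<and>
     (\<forall>x\<in>S. \<forall>s\<ge>0. \<forall>t\<ge>0. P (s + t) x = bind_pmf (P s x) (P t)) \<and>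
     (\<forall>x\<in>S. \<forall>y\<in>S. ((\<lambda>t. pmf (P t x) y) has_real_derivative
        (if x = y then - (\<Sum>\<^sub>\<infinity>z\<in>S - {x}. r x z) else r x y)) (at 0 within {0..}))"

definition stationary_distribution ::
  "'s set \<Rightarrow> ('s \<Rightarrow> 's \<Rightarrow> real) \<Rightarrow> 's pmf \<Rightarrow> bool" where
  "stationary_distribution S r \<pi> \<longleftrightarrow>
     set_pmf \<pi> \<subseteq> S \<and> (\<exists>P. ctmc_semigroup S r P \<and> (\<forall>t\<ge>0. bind_pmf \<pi> (P t) = \<pi>))"

text \<open>
  A state \<open>(u, q)\<close> of the charging station consists of the number \<open>u\<close> of uncharged EVs and the
  total number \<open>q\<close> of EVs. The power capacity is a real number, not necessarily an integer.
\<close>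
definition ev_states :: "enat \<Rightarrow> (nat \<times> nat) set" where
  "ev_states K = {(u, q). u \<le> q \<and> enat q \<le> K}"

text \<open>At most one of the four conditions below holds for a given pair of states.\<close>
fun ev_rate ::
  "real \<Rightarrow> real \<Rightarrow> real \<Rightarrow> enat \<Rightarrow> real \<Rightarrow> nat \<times> nat \<Rightarrow> nat \<times> nat \<Rightarrow> real" where
  "ev_rate lam mu nu K M (u, q) (u', q') =
     (if u' = u + 1 \<and> q' = q + 1 \<and> enat q < K then lam
      else if u = u' + 1 \<and> q' = q then nu * min (real u) M
      else if u = u' + 1 \<and> q = q' + 1 then mu * real u
      else if u' = u \<and> q = q' + 1 then mu * (real q - real u)
      else 0)"

definition ev_stationary ::
  "real \<Rightarrow> real \<Rightarrow> real \<Rightarrow> enat \<Rightarrow> real \<Rightarrow> (nat \<times> nat) pmf \<Rightarrow> bool" where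
  "ev_stationary lam mu nu K M \<pi> \<longleftrightarrow>
     stationary_distribution (ev_states K) (ev_rate lam mu nu K M) \<pi>"

definition mean_total :: "(nat \<times> nat) pmf \<Rightarrow> real" where
  "mean_total \<pi> = measure_pmf.expectation \<pi> (\<lambda>(u, q). real q)"

definition mean_charged :: "(nat \<times> nat) pmf \<Rightarrow> real" where
  "mean_charged \<pi> = measure_pmf.expectation \<pi> (\<lambda>(u, q). real q - real u)"

end

theory Submission
  imports Defs
begin

text \<open>
  Write \<open>m u = min u M\<close> for the power in use and \<open>d u = \<mu> u + \<nu> m u\<close> for the total rate at which
  uncharged EVs disappear. The generator of the chain has mean zero in stationarity, for every
  function whose jumps are bounded (\<open>stationary_drift\<close>). Applied to \<open>q\<close> and to \<open>u\<close> this gives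
  \<open>\<mu> E Q = \<lambda> P(Q < K)\<close> and \<open>\<mu> E C = \<nu> E m(U)\<close>, so that the charged fraction is
  \<open>E C / E Q = (\<nu> / \<lambda>) E m(U) / P(Q < K)\<close>.

  The upper bound is then short. As \<open>m u \<le> u\<close>, every station has \<open>(\<mu> + \<nu>) E C \<le> \<nu> E Q\<close>, with
  equality if the power suffices to charge all EVs at full rate. The law of \<open>Q\<close> is the truncated
  Poisson law, whatever the power capacity, so \<open>E Q\<close> is the same in both stations.

  For the lower bound let \<open>a = E m(U)\<close> in the infinite station, where \<open>P(Q < \<infinity>) = 1\<close>. The claim
  is that \<open>E m(U) \<ge> a P(Q < K)\<close> in the finite station. The test function is a solution \<open>G\<close>,
  depending on \<open>u\<close> only, of the Poisson equation of the infinite station: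
  \<open>\<lambda> (G (u + 1) - G u) + d u (G (u - 1) - G u) = m u - a\<close>. Its increments are written as
  \<open>G (u + 1) - G u = (e u - a) / \<lambda>\<close>. In the finite station the generator differs only by the
  arrivals that are blocked at \<open>q = K\<close>, and it maps \<open>G\<close> to \<open>m u - a 1{q < K} - e u 1{q = K}\<close>.
  Taking means, the claim follows as soon as \<open>e \<ge> 0\<close>.

  With \<open>p\<close> the law of \<open>U\<close> in the infinite station, a birth-death chain, the recursion for \<open>e\<close>
  sums up to \<open>\<lambda> p u e u = (\<Sum>i\<le>u. p i (\<lambda> m i - a d i))\<close>. The total sum of these terms is \<open>0\<close>, and
  since \<open>m i / i\<close> does not increase in \<open>i\<close>, all terms after a negative one are negative. Hence all
  partial sums are nonnegative (\<open>partial_surplus_nonneg\<close>).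
\<close>

section \<open>The generator of a stationary continuous-time Markov chain\<close>

locale locally_finite_rates =
  fixes S :: "'s set" and r :: "'s \<Rightarrow> 's \<Rightarrow> real"
  assumes countable_states: "countable S"
    and rate_nonneg: "x \<in> S \<Longrightarrow> z \<in> S \<Longrightarrow> r x z \<ge> 0"
    and finite_jump_targets: "x \<in> S \<Longrightarrow> finite {z \<in> S - {x}. r x z \<noteq> 0}"
begin

definition jumps :: "'s \<Rightarrow> 's set" where
  "jumps x = {z \<in> S - {x}. r x z \<noteq> 0}"

definition drift :: "('s \<Rightarrow> real) \<Rightarrow> 's \<Rightarrow> real" where
  "drift g x = (\<Sum>z\<in>jumps x. r x z * (g z - g x))"

definition exit_rate :: "'s \<Rightarrow> real" where
  "exit_rate x = (\<Sum>z\<in>jumps x. r x z)"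

lemma finite_jumps: "x \<in> S \<Longrightarrow> finite (jumps x)"
  using finite_jump_targets unfolding jumps_def .

lemma jumps_subset: "jumps x \<subseteq> S"
  unfolding jumps_def by auto

lemma sum_jumps_superset:
  assumes "finite T" "T \<subseteq> S - {x}" "jumps x \<subseteq> T"
  shows "(\<Sum>z\<in>jumps x. r x z * h z) = (\<Sum>z\<in>T. r x z * h z)"
  using assms by (intro sum.mono_neutral_left) (auto simp: jumps_def)

lemma exit_rate_infsum: "x \<in> S \<Longrightarrow> exit_rate x = (\<Sum>\<^sub>\<infinity>z\<in>S - {x}. r x z)"
  unfolding exit_rate_def
  by (subst infsum_finite[symmetric, OF finite_jumps], assumption, rule infsum_cong_neutral)
     (auto simp: jumps_def)

lemma exit_rate_nonneg: "x \<in> S \<Longrightarrow> exit_rate x \<ge> 0"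
  unfolding exit_rate_def using rate_nonneg jumps_subset by (blast intro: sum_nonneg)

lemma abs_drift_le:
  assumes x: "x \<in> S" and B: "\<And>z. z \<in> jumps x \<Longrightarrow> \<bar>g z - g x\<bar> \<le> B"
  shows "\<bar>drift g x\<bar> \<le> B * exit_rate x"
proof -
  have "\<bar>drift g x\<bar> \<le> (\<Sum>z\<in>jumps x. \<bar>r x z * (g z - g x)\<bar>)"
    unfolding drift_def by (rule sum_abs)
  also have "\<dots> \<le> (\<Sum>z\<in>jumps x. r x z * B)"
  proof (rule sum_mono)
    fix z assume z: "z \<in> jumps x"
    then have "r x z \<ge> 0" using x rate_nonneg jumps_subset by blast
    then show "\<bar>r x z * (g z - g x)\<bar> \<le> r x z * B"
      using B[OF z] by (simp add: abs_mult mult_left_mono)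
  qed
  finally show ?thesis by (simp add: exit_rate_def sum_distrib_left mult.commute)
qed

lemma tendsto_drift:
  assumes x: "x \<in> S" and lim: "\<And>z. z \<in> S \<Longrightarrow> (\<lambda>n. g n z) \<longlonglongrightarrow> h z"
  shows "(\<lambda>n. drift (g n) x) \<longlonglongrightarrow> drift h x"
  unfolding drift_def
  by (intro tendsto_sum tendsto_mult tendsto_diff tendsto_const lim x) (use jumps_subset in auto)

text \<open>
  For \<open>g \<ge> 0\<close> with finite support the mean of \<open>g\<close> at time \<open>t\<close>, restricted to starting points in
  \<open>F\<close>, is at most the full stationary mean of \<open>g\<close>, and equals it at time \<open>0\<close> because \<open>F\<close> contains
  the support. So its derivative at \<open>0\<close>, a finite sum of known derivatives, is not positive. Since
  \<open>F\<close> is finite, no interchange of a limit with an infinite sum is involved; the price is an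
  inequality, which already suffices to control the tails of a stationary distribution.
\<close>
lemma sum_stationary_drift_le_0:
  assumes stat: "stationary_distribution S r \<pi>"
    and A: "finite A" "A \<subseteq> S" and F: "finite F" "A \<subseteq> F" "F \<subseteq> S"
    and g: "\<And>x. g x \<ge> 0" "\<And>x. x \<notin> A \<Longrightarrow> g x = 0"
  shows "(\<Sum>x\<in>F. pmf \<pi> x * drift g x) \<le> 0"
proof -
  obtain P where P: "ctmc_semigroup S r P" and inv: "\<And>t. t \<ge> 0 \<Longrightarrow> bind_pmf \<pi> (P t) = \<pi>"
    using stat unfolding stationary_distribution_def by auto
  \<comment> \<open>the probability of starting in \<open>F\<close>, weighted with the mean of \<open>g\<close> after time \<open>t\<close>\<close>
  define h where "h t = (\<Sum>x\<in>F. pmf \<pi> x * (\<Sum>y\<in>A. pmf (P t x) y * g y))" for t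
  have P0: "x \<in> S \<Longrightarrow> P 0 x = return_pmf x" for x
    using P unfolding ctmc_semigroup_def by auto
  have deriv: "((\<lambda>t. pmf (P t x) y) has_real_derivative
      (if x = y then - exit_rate x else r x y)) (at 0 within {0..})" if "x \<in> S" "y \<in> S" for x y
    using P that unfolding ctmc_semigroup_def exit_rate_infsum[OF that(1)] by metis
  have "h t \<le> (\<Sum>y\<in>A. g y * pmf \<pi> y)" if "t \<ge> 0" for t
  proof -
    have "(\<Sum>x\<in>F. pmf \<pi> x * pmf (P t x) y) \<le> pmf \<pi> y" for y
    proof -
      have "(\<Sum>x\<in>F. pmf \<pi> x * pmf (P t x) y) = (\<integral>x. indicator F x * pmf (P t x) y \<partial>\<pi>)"
        by (subst integral_measure_pmf[OF F(1)]) (auto simp: indicator_def intro!: sum.cong)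
      also have "\<dots> \<le> (\<integral>x. pmf (P t x) y \<partial>\<pi>)"
        by (intro integral_mono measure_pmf.integrable_const_bound[where B = 1])
           (auto simp: indicator_def pmf_le_1)
      also have "\<dots> = pmf (bind_pmf \<pi> (P t)) y" by (simp add: pmf_bind)
      finally show ?thesis using inv[OF that] by simp
    qed
    then have "(\<Sum>y\<in>A. g y * (\<Sum>x\<in>F. pmf \<pi> x * pmf (P t x) y)) \<le> (\<Sum>y\<in>A. g y * pmf \<pi> y)"
      using g by (intro sum_mono mult_left_mono) auto
    moreover have "h t = (\<Sum>y\<in>A. g y * (\<Sum>x\<in>F. pmf \<pi> x * pmf (P t x) y))"
      unfolding h_def sum_distrib_left by (subst sum.swap) (simp add: mult_ac)
    ultimately show ?thesis by simp
  qed
  moreover have "h 0 = (\<Sum>y\<in>A. g y * pmf \<pi> y)"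
  proof -
    have "h 0 = (\<Sum>x\<in>F. pmf \<pi> x * (if x \<in> A then g x else 0))"
      unfolding h_def using A F P0
      by (intro sum.cong) (auto simp: subset_iff indicator_def sum.delta' if_distrib[of "\<lambda>x. x * _"]
          cong: if_cong)
    also have "\<dots> = (\<Sum>y\<in>A. g y * pmf \<pi> y)"
      using F A by (intro sum.mono_neutral_cong_right) auto
    finally show ?thesis .
  qed
  ultimately have h_le: "h t \<le> h 0" if "t \<ge> 0" for t using that by simp
  have "(h has_real_derivative (\<Sum>x\<in>F. pmf \<pi> x * (\<Sum>y\<in>A. (if x = y then - exit_rate x else r x y) * g y)))
    (at 0 within {0..})"
    unfolding h_def using A F
    by (intro DERIV_sum DERIV_cmult DERIV_cmult_right deriv) auto
  moreover have "(\<Sum>y\<in>A. (if x = y then - exit_rate x else r x y) * g y) = drift g x" if "x \<in> F" for x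
  proof -
    have x: "x \<in> S" using that F by auto
    have "(\<Sum>y\<in>A. (if x = y then - exit_rate x else r x y) * g y)
        = (\<Sum>y\<in>insert x (A \<union> jumps x). (if x = y then - exit_rate x else r x y) * g y)"
      using A finite_jumps[OF x] g by (intro sum.mono_neutral_left) auto
    also have "\<dots> = - exit_rate x * g x + (\<Sum>y\<in>(A \<union> jumps x) - {x}. r x y * g y)"
      using A finite_jumps[OF x] by (subst sum.insert_remove) (auto intro!: sum.cong split: if_splits)
    also have "(\<Sum>y\<in>(A \<union> jumps x) - {x}. r x y * g y) = (\<Sum>y\<in>jumps x. r x y * g y)"
      using A finite_jumps[OF x] by (intro sum.mono_neutral_right) (auto simp: jumps_def)
    finally show ?thesis
      by (simp add: drift_def exit_rate_def sum_subtractf right_diff_distrib sum_distrib_right)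
  qed
  ultimately have "(h has_real_derivative (\<Sum>x\<in>F. pmf \<pi> x * drift g x)) (at 0 within {0..})" by simp
  then have lim: "((\<lambda>t. (h t - h 0) / t) \<longlongrightarrow> (\<Sum>x\<in>F. pmf \<pi> x * drift g x)) (at 0 within {0..})"
    by (simp add: has_field_derivative_iff)
  show ?thesis
    by (rule tendsto_upperbound[OF lim])
       (auto simp: eventually_at_filter divide_nonpos_nonneg h_le at_within_Ici_at_right)
qed

text \<open>
  Exhaust the countable state space by finite sets \<open>A n\<close> and cut \<open>g\<close> off outside \<open>A n\<close>; the
  integrable exit rate dominates all the drifts.
\<close>
lemma stationary_drift_le_0:
  assumes stat: "stationary_distribution S r \<pi>"
    and int: "integrable \<pi> exit_rate"
    and g: "\<And>x. g x \<ge> 0" "\<And>x. g x \<le> B"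
  shows "measure_pmf.expectation \<pi> (drift g) \<le> 0"
proof -
  have supp: "set_pmf \<pi> \<subseteq> S" using stat by (auto simp: stationary_distribution_def)
  define A where "A n = {x \<in> S. to_nat_on S x \<le> n}" for n :: nat
  have finA: "finite (A n)" for n
  proof (rule finite_imageD[of "to_nat_on S"])
    show "finite (to_nat_on S ` A n)"
      by (rule finite_subset[of _ "{..n}"]) (auto simp: A_def)
    show "inj_on (to_nat_on S) (A n)"
      using inj_on_to_nat_on[OF countable_states] by (rule inj_on_subset) (auto simp: A_def)
  qed
  have inA: "\<forall>\<^sub>F n in sequentially. x \<in> A n" if "x \<in> S" for x
    using that by (auto simp: A_def intro: eventually_ge_at_top)
  define gA where "gA n x = indicator (A n) x * g x" for n x
  have lim_gA: "(\<lambda>n. gA n x) \<longlonglongrightarrow> g x" if "x \<in> S" for x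
    by (rule tendsto_eventually, rule eventually_mono[OF inA[OF that]]) (simp add: gA_def)
  have "(\<lambda>n. \<integral>x. indicator (A n) x * drift (gA n) x \<partial>\<pi>) \<longlonglongrightarrow> measure_pmf.expectation \<pi> (drift g)"
  proof (rule integral_dominated_convergence[where w = "\<lambda>x. B * exit_rate x"])
    show "AE x in \<pi>. (\<lambda>n. indicator (A n) x * drift (gA n) x) \<longlonglongrightarrow> drift g x"
    proof (rule AE_pmfI)
      fix x assume "x \<in> set_pmf \<pi>"
      then have x: "x \<in> S" using supp by auto
      have "\<forall>\<^sub>F n in sequentially. drift (gA n) x = indicator (A n) x * drift (gA n) x"
        by (rule eventually_mono[OF inA[OF x]]) simp
      with tendsto_drift[of x gA g, OF x lim_gA]
      show "(\<lambda>n. indicator (A n) x * drift (gA n) x) \<longlonglongrightarrow> drift g x"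
        by (rule Lim_transform_eventually)
    qed
    show "AE x in \<pi>. norm (indicator (A n) x * drift (gA n) x) \<le> B * exit_rate x" for n
    proof (rule AE_pmfI)
      fix x assume "x \<in> set_pmf \<pi>"
      then have x: "x \<in> S" using supp by auto
      have "0 \<le> gA n z \<and> gA n z \<le> B" for z
        using g[of z] by (auto simp: gA_def indicator_def)
      then have "\<bar>gA n z - gA n x\<bar> \<le> B" for z by (smt (verit))
      then have "\<bar>drift (gA n) x\<bar> \<le> B * exit_rate x"
        using abs_drift_le[OF x] by blast
      then show "norm (indicator (A n) x * drift (gA n) x) \<le> B * exit_rate x"
        by (auto simp: indicator_def)
    qed
  qed (use int in auto)
  moreover have "(\<integral>x. indicator (A n) x * drift (gA n) x \<partial>\<pi>) \<le> 0" for n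
  proof -
    have "(\<integral>x. indicator (A n) x * drift (gA n) x \<partial>\<pi>) = (\<Sum>x\<in>A n. pmf \<pi> x * drift (gA n) x)"
      by (subst integral_measure_pmf[OF finA[of n]]) (auto simp: indicator_def intro!: sum.cong)
    also have "\<dots> \<le> 0"
      using g by (intro sum_stationary_drift_le_0[OF stat, of "A n"] finA) (auto simp: A_def gA_def)
    finally show ?thesis .
  qed
  ultimately show ?thesis by (intro LIMSEQ_le_const2) auto
qed

text \<open>
  The inequality holds for \<open>g + B\<close> and for \<open>B - g\<close>, whose drifts are opposite to each other.
\<close>
lemma stationary_drift_bounded:
  assumes stat: "stationary_distribution S r \<pi>"
    and int: "integrable \<pi> exit_rate"
    and g: "\<And>x. \<bar>g x\<bar> \<le> B"
  shows "measure_pmf.expectation \<pi> (drift g) = 0"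
proof -
  have gB: "- B \<le> g x" "g x \<le> B" for x using g[of x] by auto
  have "drift (\<lambda>x. g x + B) = drift g" "drift (\<lambda>x. B - g x) = (\<lambda>x. - drift g x)"
    by (auto simp: drift_def fun_eq_iff sum_negf[symmetric] intro!: sum.cong simp: algebra_simps)
  with stationary_drift_le_0[OF stat int, of "\<lambda>x. g x + B" "2 * B"]
    stationary_drift_le_0[OF stat int, of "\<lambda>x. B - g x" "2 * B"] gB
  show ?thesis by (simp add: algebra_simps) (smt (verit))
qed

text \<open>
  Clamping \<open>g\<close> to \<open>[-n, n]\<close> makes it bounded and does not enlarge its jumps, so the bounded case
  carries over by dominated convergence.
\<close>
theorem stationary_drift:
  assumes stat: "stationary_distribution S r \<pi>"
    and int: "integrable \<pi> exit_rate"
    and g: "\<And>x z. x \<in> S \<Longrightarrow> z \<in> jumps x \<Longrightarrow> \<bar>g z - g x\<bar> \<le> B"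
  shows "measure_pmf.expectation \<pi> (drift g) = 0"
proof -
  define gn where "gn n x = max (- real n) (min (real n) (g x))" for n x
  have contr: "\<bar>gn n z - gn n x\<bar> \<le> \<bar>g z - g x\<bar>" for n x z
    by (auto simp: gn_def max_def min_def)
  have lim_gn: "(\<lambda>n. gn n x) \<longlonglongrightarrow> g x" for x
  proof (rule tendsto_eventually)
    show "\<forall>\<^sub>F n in sequentially. gn n x = g x"
      using eventually_ge_at_top[of "nat \<lceil>\<bar>g x\<bar>\<rceil>"]
    proof eventually_elim
      case (elim n)
      then have "\<bar>g x\<bar> \<le> real n" by linarith
      then show ?case by (auto simp: gn_def)
    qed
  qed
  have supp: "x \<in> S" if "x \<in> set_pmf \<pi>" for x
    using stat that by (auto simp: stationary_distribution_def)
  have "(\<lambda>n. measure_pmf.expectation \<pi> (drift (gn n))) \<longlonglongrightarrow> measure_pmf.expectation \<pi> (drift g)"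
  proof (rule integral_dominated_convergence[where w = "\<lambda>x. B * exit_rate x"])
    show "AE x in \<pi>. (\<lambda>n. drift (gn n) x) \<longlonglongrightarrow> drift g x"
      using supp by (auto intro!: AE_pmfI tendsto_drift lim_gn)
    show "AE x in \<pi>. norm (drift (gn n) x) \<le> B * exit_rate x" for n
      using supp order_trans[OF contr g] by (auto intro!: AE_pmfI abs_drift_le)
  qed (use int in auto)
  moreover have "measure_pmf.expectation \<pi> (drift (gn n)) = 0" for n
    by (rule stationary_drift_bounded[OF stat int, of _ "real n"]) (auto simp: gn_def)
  ultimately show ?thesis by (simp add: LIMSEQ_const_iff)
qed

end

section \<open>Laws on the natural numbers given by a one-step recursion\<close>

text \<open>
  The recursion determines a law up to the factor \<open>p 0\<close>, and normalisation fixes the factor. Stating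
  the proportionality as a cross product avoids dividing by \<open>p 0\<close> or by \<open>p' 0\<close>.
\<close>
lemma pmf_nat_eqI_detailed_balance:
  fixes p p' :: "nat pmf" and b d :: "nat \<Rightarrow> real"
  assumes p: "\<And>n. b n * pmf p n = d n * pmf p (Suc n)"
    and p': "\<And>n. b n * pmf p' n = d n * pmf p' (Suc n)"
    and d: "\<And>n. d n > 0"
  shows "p = p'"
proof -
  have cross: "pmf p n * pmf p' 0 = pmf p' n * pmf p 0" for n
  proof (induction n)
    case (Suc n)
    have "d n * (pmf p (Suc n) * pmf p' 0) = b n * (pmf p n * pmf p' 0)"
      using p[of n] by (metis mult.assoc)
    also have "\<dots> = d n * (pmf p' (Suc n) * pmf p 0)"
      unfolding Suc.IH using p'[of n] by (metis mult.assoc)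
    finally show ?case using d[of n] by simp
  qed simp
  have total: "(\<integral>n. pmf q n \<partial>count_space UNIV) = 1" for q :: "nat pmf"
    by (simp add: integral_pmf)
  have "pmf p' 0 = pmf p 0"
  proof -
    have "(\<integral>n. pmf p n * pmf p' 0 \<partial>count_space UNIV) = (\<integral>n. pmf p' n * pmf p 0 \<partial>count_space UNIV)"
      by (simp only: cross)
    then show ?thesis by (simp add: total)
  qed
  moreover have "pmf p 0 \<noteq> 0"
  proof
    assume 0: "pmf p 0 = 0"
    have "pmf p n = 0" for n
    proof (induction n)
      case (Suc n)
      then show ?case using p[of n] d[of n] by simp
    qed (fact 0)
    then show False using total[of p] by simp
  qed
  ultimately show ?thesis using cross by (intro pmf_eqI) simp
qed

lemma integrable_pmf_nat_if_ratio_bound: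
  fixes p :: "nat pmf" and b :: real
  assumes b: "\<And>n. real (Suc n) * pmf p (Suc n) \<le> b * pmf p n"
  shows "integrable p real"
proof -
  have "summable (pmf p)"
    using integrable_pmf[of UNIV p] by (simp add: integrable_count_space_nat_iff)
  then have "summable (\<lambda>n. b * pmf p n)" by (rule summable_mult)
  then have "summable (\<lambda>n. real (Suc n) * pmf p (Suc n))"
    by (rule summable_comparison_test') (use b in simp)
  then have "summable (\<lambda>n. pmf p n * real n)"
    by (subst summable_Suc_iff[symmetric]) (simp add: mult.commute)
  then show ?thesis
    unfolding measure_pmf_eq_density
    by (subst integrable_density) (auto simp: integrable_count_space_nat_iff)
qed

section \<open>The rates of the charging station\<close>

locale charging_station =
  fixes lam mu nu :: real and K :: enat and M :: real
  assumes lam_pos: "lam > 0" and mu_pos: "mu > 0" and nu_pos: "nu > 0"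
    and K_pos: "K > 0" and M_pos: "M > 0"
begin

abbreviation "S \<equiv> ev_states K"
abbreviation "r \<equiv> ev_rate lam mu nu K M"

definition charging_power :: "nat \<Rightarrow> real" where
  "charging_power u = min (real u) M"

definition loss_rate :: "nat \<Rightarrow> real" where
  "loss_rate u = mu * real u + nu * charging_power u"

lemma charging_power_0 [simp]: "charging_power 0 = 0"
  using M_pos by (simp add: charging_power_def)

lemma loss_rate_0 [simp]: "loss_rate 0 = 0"
  by (simp add: loss_rate_def)

lemma charging_power_bounds: "0 \<le> charging_power u" "charging_power u \<le> real u"
  using M_pos by (auto simp: charging_power_def)

text \<open>
  The targets of downward jumps are included only when their rates do not vanish for trivial
  reasons, so that truncated subtraction never produces the state itself.
\<close>
definition targets :: "nat \<Rightarrow> nat \<Rightarrow> (nat \<times> nat) set" where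
  "targets u q = (if enat q < K then {(u + 1, q + 1)} else {}) \<union>
     (if u > 0 then {(u - 1, q), (u - 1, q - 1)} else {}) \<union> (if u < q then {(u, q - 1)} else {})"

lemma targets_subset: "(u, q) \<in> S \<Longrightarrow> targets u q \<subseteq> S - {(u, q)}"
  by (auto simp: targets_def ev_states_def Suc_ile_eq intro: order_trans[rotated] split: if_splits)

lemma rate_0_outside_targets:
  "(u, q) \<in> S \<Longrightarrow> z \<in> S \<Longrightarrow> r (u, q) z \<noteq> 0 \<Longrightarrow> z \<in> targets u q"
  by (cases z) (auto simp: targets_def ev_states_def split: if_splits)

sublocale locally_finite_rates S r
proof
  show "r x z \<ge> 0" if "x \<in> S" "z \<in> S" for x z
    using that lam_pos mu_pos nu_pos M_pos by (cases x; cases z) (auto simp: ev_states_def)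
  show "finite {z \<in> S - {x}. r x z \<noteq> 0}" if "x \<in> S" for x
  proof (cases x)
    case (Pair u q)
    have "{z \<in> S - {x}. r x z \<noteq> 0} \<subseteq> targets u q"
      using rate_0_outside_targets[of u q] that unfolding Pair by blast
    moreover have "finite (targets u q)" by (simp add: targets_def)
    ultimately show ?thesis by (rule finite_subset)
  qed
qed simp

lemma jumps_subset_targets: "(u, q) \<in> S \<Longrightarrow> jumps (u, q) \<subseteq> targets u q"
  using rate_0_outside_targets by (auto simp: jumps_def)

text \<open>
  On the right-hand side the truncated predecessors \<open>u - 1\<close> and \<open>q - 1\<close> are harmless: where they are
  not the true predecessors, the rate in front of them is \<open>0\<close>.
\<close>
lemma sum_jumps:
  assumes "(u, q) \<in> S"
  shows "(\<Sum>z\<in>jumps (u, q). r (u, q) z * h z) =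
    (if enat q < K then lam * h (u + 1, q + 1) else 0) + nu * charging_power u * h (u - 1, q)
    + mu * real u * h (u - 1, q - 1) + mu * (real q - real u) * h (u, q - 1)"
proof -
  have "u \<le> q" using assms by (simp add: ev_states_def)
  have "(\<Sum>z\<in>jumps (u, q). r (u, q) z * h z) = (\<Sum>z\<in>targets u q. r (u, q) z * h z)"
    by (intro sum_jumps_superset targets_subset jumps_subset_targets assms) (simp add: targets_def)
  also have "\<dots> = (if enat q < K then lam * h (u + 1, q + 1) else 0) + nu * charging_power u * h (u - 1, q)
    + mu * real u * h (u - 1, q - 1) + mu * (real q - real u) * h (u, q - 1)"
    using \<open>u \<le> q\<close> M_pos
    by (cases "u = 0"; cases "u = q"; cases "enat q < K") (auto simp: targets_def charging_power_def)
  finally show ?thesis .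
qed

lemma drift_uncharged:
  assumes "(u, q) \<in> S"
  shows "drift (\<lambda>(u, q). f u) (u, q) =
    (if enat q < K then lam * (f (Suc u) - f u) else 0) + loss_rate u * (f (u - 1) - f u)"
  unfolding drift_def using sum_jumps[OF assms, of "\<lambda>(u', q'). f u' - f u"]
  by (simp add: case_prod_beta loss_rate_def algebra_simps)

lemma drift_total:
  assumes "(u, q) \<in> S"
  shows "drift (\<lambda>(u, q). f q) (u, q) =
    (if enat q < K then lam * (f (Suc q) - f q) else 0) + mu * real q * (f (q - 1) - f q)"
  unfolding drift_def using sum_jumps[OF assms, of "\<lambda>(u', q'). f q' - f q"]
  by (simp add: case_prod_beta algebra_simps)

lemma exit_rate_le:
  assumes "(u, q) \<in> S"
  shows "exit_rate (u, q) \<le> lam + (mu + nu) * real q"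
proof -
  have "u \<le> q" using assms by (simp add: ev_states_def)
  then have "charging_power u \<le> real q" using charging_power_bounds(2)[of u] by simp
  then have "nu * charging_power u \<le> nu * real q" using nu_pos by simp
  then show ?thesis
    using sum_jumps[OF assms, of "\<lambda>_. 1"] lam_pos
    by (simp add: exit_rate_def algebra_simps split: if_splits)
qed

end

section \<open>Balance equations in stationarity\<close>

locale stationary_station = charging_station +
  fixes \<pi> :: "(nat \<times> nat) pmf"
  assumes stationary: "ev_stationary lam mu nu K M \<pi>"
begin

lemma stat: "stationary_distribution S r \<pi>"
  using stationary by (simp add: ev_stationary_def)

lemma support: "(u, q) \<in> set_pmf \<pi> \<Longrightarrow> (u, q) \<in> S"
  using stat by (auto simp: stationary_distribution_def)

abbreviation E :: "(nat \<times> nat \<Rightarrow> real) \<Rightarrow> real" where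
  "E \<equiv> measure_pmf.expectation \<pi>"

lemma E_cong: "(\<And>u q. (u, q) \<in> S \<Longrightarrow> f (u, q) = g (u, q)) \<Longrightarrow> E f = E g"
  by (intro integral_cong_AE AE_pmfI) (use support in auto)

lemma pmf_marginal:
  "pmf (map_pmf g \<pi>) n = E (\<lambda>x. indicator {n} (g x))" for g :: "nat \<times> nat \<Rightarrow> nat"
proof -
  have "pmf (map_pmf g \<pi>) n = E (indicator (g -` {n}))" by (simp add: pmf_map)
  also have "\<dots> = E (\<lambda>x. indicator {n} (g x))"
    by (rule arg_cong[of _ _ E]) (auto simp: indicator_def)
  finally show ?thesis .
qed

lemma integrable_bounded: "(\<And>x. \<bar>f x\<bar> \<le> B) \<Longrightarrow> integrable \<pi> f" for f :: "nat \<times> nat \<Rightarrow> real"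
  by (rule measure_pmf.integrable_const_bound[where B = B]) auto

lemma mean_marginal_difference:
  "E (\<lambda>x. a * indicator {m} (f x) - b * indicator {n} (f x))
    = a * pmf (map_pmf f \<pi>) m - b * pmf (map_pmf f \<pi>) n" for f :: "nat \<times> nat \<Rightarrow> nat"
proof -
  have "integrable \<pi> (\<lambda>x. indicator {k} (f x) :: real)" for k
    by (rule integrable_bounded[of _ 1]) (simp add: indicator_def)
  then show ?thesis by (simp add: pmf_marginal)
qed

text \<open>
  This is the flow between \<open>{q \<le> n}\<close> and its complement, as an inequality: the indicator of a finite
  set is an admissible test function before any integrability is known. It bounds the tail of \<open>Q\<close>
  and thereby makes the exit rate integrable.
\<close>
lemma total_ratio_bound:
  "mu * real (Suc n) * pmf (map_pmf snd \<pi>) (Suc n) \<le> lam * pmf (map_pmf snd \<pi>) n"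
proof -
  define A where "A k = {x \<in> S. snd x \<le> k}" for k
  define g :: "nat \<times> nat \<Rightarrow> real" where "g = indicator (A n)"
  define h :: "nat \<times> nat \<Rightarrow> real" where
    "h x = mu * real (Suc n) * indicator {Suc n} (snd x) - lam * indicator {n} (snd x)" for x
  have fin: "finite (A k)" for k
    by (rule finite_subset[of _ "{..k} \<times> {..k}"]) (auto simp: A_def ev_states_def)
  have "h x \<le> drift g x" if "x \<in> A (Suc n)" for x
  proof -
    obtain u q where x: "x = (u, q)" by (cases x)
    have inS: "(u, q) \<in> S" and q: "q \<le> Suc n" using that x by (auto simp: A_def)
    have "drift g (u, q) = drift (\<lambda>(u, q). indicator {..n} q) (u, q)"
      unfolding drift_def using jumps_subset[of "(u, q)"] inS
      by (intro sum.cong refl) (auto simp: g_def A_def indicator_def)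
    then show ?thesis
      using q lam_pos mu_pos by (auto simp: x drift_total[OF inS] h_def indicator_def)
  qed
  then have "(\<Sum>x\<in>A (Suc n). pmf \<pi> x * h x) \<le> (\<Sum>x\<in>A (Suc n). pmf \<pi> x * drift g x)"
    by (intro sum_mono mult_left_mono) auto
  also have "\<dots> \<le> 0"
    by (rule sum_stationary_drift_le_0[OF stat, of "A n"]) (use fin in \<open>auto simp: A_def g_def\<close>)
  also have "(\<Sum>x\<in>A (Suc n). pmf \<pi> x * h x) = E h"
  proof (subst integral_measure_pmf[OF fin[of "Suc n"]])
    fix x assume "x \<in> set_pmf \<pi>" "h x \<noteq> 0"
    moreover from \<open>h x \<noteq> 0\<close> have "snd x \<le> Suc n"
      by (rule contrapos_np) (simp add: h_def)
    ultimately show "x \<in> A (Suc n)" using support[of "fst x" "snd x"] by (simp add: A_def)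
  qed simp
  also have "E h = mu * real (Suc n) * pmf (map_pmf snd \<pi>) (Suc n) - lam * pmf (map_pmf snd \<pi>) n"
    unfolding h_def by (rule mean_marginal_difference)
  finally show ?thesis by simp
qed

lemma integrable_total: "integrable \<pi> (\<lambda>x. real (snd x))"
proof -
  have "integrable (map_pmf snd \<pi>) real"
    using total_ratio_bound mu_pos
    by (intro integrable_pmf_nat_if_ratio_bound[where b = "lam / mu"]) (simp add: field_simps)
  then show ?thesis by simp
qed

lemma integrable_linear_growth:
  fixes f :: "nat \<times> nat \<Rightarrow> real"
  assumes "\<And>u q. (u, q) \<in> S \<Longrightarrow> \<bar>f (u, q)\<bar> \<le> A + B * real q"
  shows "integrable \<pi> f"
proof (rule Bochner_Integration.integrable_bound)
  show "integrable \<pi> (\<lambda>x. A + B * real (snd x))" using integrable_total by simp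
  show "AE x in \<pi>. norm (f x) \<le> norm (A + B * real (snd x))"
    by (rule AE_pmfI) (use assms support in \<open>fastforce intro: order_trans[OF _ abs_ge_self]\<close>)
qed simp

lemma integrable_exit_rate: "integrable \<pi> exit_rate"
  by (rule integrable_linear_growth[of _ lam "mu + nu"])
     (use exit_rate_le exit_rate_nonneg in fastforce)

text \<open>
  Every jump moves \<open>u\<close> and \<open>q\<close> by at most one. The increments are bounded only below \<open>K\<close>, because
  for a finite station the test function may grow arbitrarily fast.
\<close>
lemma jump_increments:
  assumes f: "\<And>n. enat n < K \<Longrightarrow> \<bar>f (Suc n) - f n\<bar> \<le> B"
    and x: "(u, q) \<in> S" "(u', q') \<in> jumps (u, q)"
  shows "\<bar>f u' - f u\<bar> \<le> B" "\<bar>f q' - f q\<bar> \<le> (B :: real)"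
proof -
  have "u \<le> q" "enat q \<le> K" using x by (auto simp: ev_states_def)
  have "B \<ge> 0" using f[of 0] K_pos by (simp add: zero_enat_def)
  have down: "\<bar>f (k - 1) - f k\<bar> \<le> B" if "0 < k" "k \<le> q" for k
  proof -
    have "enat (k - 1) < enat q" using that by simp
    then have "enat (k - 1) < K" using \<open>enat q \<le> K\<close> by (rule less_le_trans)
    then show ?thesis using f[of "k - 1"] that by (simp add: abs_minus_commute)
  qed
  have up: "\<bar>f (Suc k) - f k\<bar> \<le> B" if "k \<le> q" "enat q < K" for k
    using f[of k] that le_less_trans[of "enat k" "enat q" K] by simp
  have "(u', q') \<in> targets u q" using jumps_subset_targets x by blast
  then show "\<bar>f u' - f u\<bar> \<le> B" "\<bar>f q' - f q\<bar> \<le> B"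
    using \<open>u \<le> q\<close> \<open>B \<ge> 0\<close> down[of u] down[of q] up[of u] up[of q]
    by (auto simp: targets_def split: if_splits)
qed

lemma mean_drift_uncharged:
  assumes "\<And>n. enat n < K \<Longrightarrow> \<bar>f (Suc n) - f n\<bar> \<le> B"
  shows "E (\<lambda>(u, q). (if enat q < K then lam * (f (Suc u) - f u) else 0)
    + loss_rate u * (f (u - 1) - f u)) = 0"
proof -
  have "E (drift (\<lambda>(u, q). f u)) = 0"
    by (rule stationary_drift[OF stat integrable_exit_rate]) (use jump_increments(1)[of f, OF assms] in fastforce)
  then show ?thesis
    by (subst E_cong[where g = "drift (\<lambda>(u, q). f u)"]) (simp_all add: drift_uncharged)
qed

lemma mean_drift_total:
  assumes "\<And>n. enat n < K \<Longrightarrow> \<bar>f (Suc n) - f n\<bar> \<le> B"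
  shows "E (\<lambda>(u, q). (if enat q < K then lam * (f (Suc q) - f q) else 0)
    + mu * real q * (f (q - 1) - f q)) = 0"
proof -
  have "E (drift (\<lambda>(u, q). f q)) = 0"
    by (rule stationary_drift[OF stat integrable_exit_rate]) (use jump_increments(2)[of f, OF assms] in fastforce)
  then show ?thesis
    by (subst E_cong[where g = "drift (\<lambda>(u, q). f q)"]) (simp_all add: drift_total)
qed

text \<open>
  As Poisson arrivals see time averages, this is the probability that an arriving EV finds a space.
\<close>
definition accept_prob :: real where
  "accept_prob = E (\<lambda>x. of_bool (enat (snd x) < K))"

definition mean_power :: real where
  "mean_power = E (\<lambda>x. charging_power (fst x))"

lemma integrable_uncharged: "integrable \<pi> (\<lambda>x. real (fst x))"
  by (rule integrable_linear_growth[of _ 0 1]) (simp add: ev_states_def)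

lemma integrable_power: "integrable \<pi> (\<lambda>x. charging_power (fst x))"
  by (rule Bochner_Integration.integrable_bound[OF integrable_uncharged])
     (use charging_power_bounds in auto)

lemma integrable_accept: "integrable \<pi> (\<lambda>x. of_bool (enat (snd x) < K) :: real)"
  by (rule integrable_bounded[of _ 1]) simp

lemma accept_prob_infinite: "K = \<infinity> \<Longrightarrow> accept_prob = 1"
  unfolding accept_prob_def by (rule trans[OF E_cong[of _ "\<lambda>_. 1"]]) auto

lemma mean_total_eq: "mean_total \<pi> = E (\<lambda>x. real (snd x))"
  by (simp add: mean_total_def case_prod_unfold)

lemma mean_total_balance: "mu * mean_total \<pi> = lam * accept_prob"
proof -
  have "0 = E (\<lambda>(u, q). (if enat q < K then lam * (real (Suc q) - real q) else 0)
      + mu * real q * (real (q - 1) - real q))"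
    by (rule mean_drift_total[of real 1, symmetric]) simp
  also have "\<dots> = E (\<lambda>x. lam * of_bool (enat (snd x) < K) - mu * real (snd x))"
  proof (rule E_cong)
    fix u q
    show "(case (u, q) of (u, q) \<Rightarrow> (if enat q < K then lam * (real (Suc q) - real q) else 0)
      + mu * real q * (real (q - 1) - real q))
      = lam * of_bool (enat (snd (u, q)) < K) - mu * real (snd (u, q))"
      by (cases q) (auto simp: algebra_simps)
  qed
  also have "\<dots> = lam * accept_prob - mu * mean_total \<pi>"
    using integrable_total integrable_accept by (simp add: accept_prob_def mean_total_eq)
  finally show ?thesis by simp
qed

lemma throughput_balance: "mu * E (\<lambda>x. real (fst x)) + nu * mean_power = lam * accept_prob"
proof -
  have "0 = E (\<lambda>(u, q). (if enat q < K then lam * (real (Suc u) - real u) else 0)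
      + loss_rate u * (real (u - 1) - real u))"
    by (rule mean_drift_uncharged[of real 1, symmetric]) simp
  also have "\<dots> = E (\<lambda>x. lam * of_bool (enat (snd x) < K) - mu * real (fst x) - nu * charging_power (fst x))"
  proof (rule E_cong)
    fix u q
    show "(case (u, q) of (u, q) \<Rightarrow> (if enat q < K then lam * (real (Suc u) - real u) else 0)
      + loss_rate u * (real (u - 1) - real u))
      = lam * of_bool (enat (snd (u, q)) < K) - mu * real (fst (u, q)) - nu * charging_power (fst (u, q))"
      by (cases u) (auto simp: loss_rate_def algebra_simps)
  qed
  also have "\<dots> = lam * accept_prob - mu * E (\<lambda>x. real (fst x)) - nu * mean_power"
    using integrable_uncharged integrable_power integrable_accept
    by (simp add: accept_prob_def mean_power_def)
  finally show ?thesis by simp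
qed

lemma mean_charged_eq: "mean_charged \<pi> = mean_total \<pi> - E (\<lambda>x. real (fst x))"
  using Bochner_Integration.integral_diff[OF integrable_total integrable_uncharged]
  by (simp add: mean_charged_def mean_total_eq case_prod_unfold)

lemma mean_charged_balance: "mu * mean_charged \<pi> = nu * mean_power"
  using mean_total_balance throughput_balance by (simp add: mean_charged_eq algebra_simps)

lemma mean_total_pos: "mean_total \<pi> > 0"
proof -
  have "mean_total \<pi> \<ge> 0" unfolding mean_total_eq by simp
  moreover have "mean_total \<pi> \<noteq> 0"
  proof
    assume 0: "mean_total \<pi> = 0"
    then have "AE x in \<pi>. real (snd x) = 0"
      using integral_nonneg_eq_0_iff_AE[OF integrable_total] by (simp add: mean_total_eq)
    then have "AE x in \<pi>. of_bool (enat (snd x) < K) = (1 :: real)"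
      by (rule eventually_mono) (use K_pos in \<open>simp add: zero_enat_def\<close>)
    then have "accept_prob = E (\<lambda>_. 1)"
      unfolding accept_prob_def by (intro integral_cong_AE) auto
    then show False using mean_total_balance 0 lam_pos by simp
  qed
  ultimately show ?thesis by simp
qed

lemma charged_fraction_eq:
  "mean_charged \<pi> / mean_total \<pi> = (nu / lam) * (mean_power / accept_prob)"
proof -
  have "mean_charged \<pi> / mean_total \<pi> = (mu * mean_charged \<pi>) / (mu * mean_total \<pi>)"
    using mu_pos by simp
  then show ?thesis by (simp add: mean_charged_balance mean_total_balance)
qed

lemma accept_prob_pos: "accept_prob > 0"
  using mean_total_balance mean_total_pos mu_pos lam_pos by (metis mult_pos_pos zero_less_mult_pos)

lemma total_balance:
  "(if enat n < K then lam else 0) * pmf (map_pmf snd \<pi>) n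
    = mu * real (Suc n) * pmf (map_pmf snd \<pi>) (Suc n)"
proof -
  have "0 = E (\<lambda>(u, q). (if enat q < K then lam * (indicator {..n} (Suc q) - indicator {..n} q) else 0)
      + mu * real q * (indicator {..n} (q - 1) - indicator {..n} q))"
    by (rule mean_drift_total[of "indicator {..n}" 1, symmetric]) (simp add: indicator_def)
  also have "\<dots> = E (\<lambda>x. mu * real (Suc n) * indicator {Suc n} (snd x)
      - (if enat n < K then lam else 0) * indicator {n} (snd x))"
  proof (rule E_cong)
    fix u q
    consider "q < n" | "q = n" | "q = Suc n" | "q > Suc n" by linarith
    then show "(case (u, q) of (u, q) \<Rightarrow>
        (if enat q < K then lam * (indicator {..n} (Suc q) - indicator {..n} q) else 0)
        + mu * real q * (indicator {..n} (q - 1) - indicator {..n} q))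
      = mu * real (Suc n) * indicator {Suc n} (snd (u, q))
        - (if enat n < K then lam else 0) * indicator {n} (snd (u, q))"
      by cases (auto simp: indicator_def)
  qed
  also have "\<dots> = mu * real (Suc n) * pmf (map_pmf snd \<pi>) (Suc n)
      - (if enat n < K then lam else 0) * pmf (map_pmf snd \<pi>) n"
    by (rule mean_marginal_difference)
  finally show ?thesis by simp
qed

text \<open>
  Without blocking, \<open>U\<close> alone is a birth-death chain, and its cut equation closes. In a finite
  station the arrival rate depends on \<open>q\<close>, and there is no such equation.
\<close>
lemma uncharged_balance:
  assumes "K = \<infinity>"
  shows "lam * pmf (map_pmf fst \<pi>) n = loss_rate (Suc n) * pmf (map_pmf fst \<pi>) (Suc n)"
proof -
  have "0 = E (\<lambda>(u, q). (if enat q < K then lam * (indicator {..n} (Suc u) - indicator {..n} u) else 0)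
      + loss_rate u * (indicator {..n} (u - 1) - indicator {..n} u))"
    by (rule mean_drift_uncharged[of "indicator {..n}" 1, symmetric]) (simp add: indicator_def)
  also have "\<dots> = E (\<lambda>x. loss_rate (Suc n) * indicator {Suc n} (fst x) - lam * indicator {n} (fst x))"
  proof (rule E_cong)
    fix u q
    consider "u < n" | "u = n" | "u = Suc n" | "u > Suc n" by linarith
    then show "(case (u, q) of (u, q) \<Rightarrow>
        (if enat q < K then lam * (indicator {..n} (Suc u) - indicator {..n} u) else 0)
        + loss_rate u * (indicator {..n} (u - 1) - indicator {..n} u))
      = loss_rate (Suc n) * indicator {Suc n} (fst (u, q)) - lam * indicator {n} (fst (u, q))"
      by cases (auto simp: indicator_def assms)
  qed
  also have "\<dots> = loss_rate (Suc n) * pmf (map_pmf fst \<pi>) (Suc n) - lam * pmf (map_pmf fst \<pi>) n"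
    by (rule mean_marginal_difference)
  finally show ?thesis by simp
qed

lemma mean_charged_le: "(mu + nu) * mean_charged \<pi> \<le> nu * mean_total \<pi>"
proof -
  have "mean_power \<le> E (\<lambda>x. real (fst x))"
    unfolding mean_power_def
    by (intro integral_mono integrable_power integrable_uncharged charging_power_bounds)
  then have "nu * mean_power \<le> nu * (mean_total \<pi> - mean_charged \<pi>)"
    using nu_pos by (simp add: mean_charged_eq)
  then show ?thesis using mean_charged_balance by (simp add: algebra_simps)
qed

lemma mean_charged_full_power:
  assumes "\<And>n. enat n \<le> K \<Longrightarrow> real n \<le> M"
  shows "(mu + nu) * mean_charged \<pi> = nu * mean_total \<pi>"
proof -
  have "mean_power = E (\<lambda>x. real (fst x))"
    unfolding mean_power_def
  proof (rule E_cong)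
    fix u q assume "(u, q) \<in> S"
    then have "enat u \<le> K" by (auto simp: ev_states_def intro: order_trans[rotated])
    then show "charging_power (fst (u, q)) = real (fst (u, q))"
      using assms by (simp add: charging_power_def)
  qed
  then have "nu * mean_power = nu * (mean_total \<pi> - mean_charged \<pi>)"
    by (simp add: mean_charged_eq)
  then show ?thesis using mean_charged_balance by (simp add: algebra_simps)
qed

end

text \<open>
  \<open>Q\<close> is a loss system by itself: each EV, charged or not, leaves at rate \<open>\<mu>\<close>.
\<close>
lemma law_of_total_unique:
  assumes "stationary_station lam mu nu K M \<pi>" "stationary_station lam mu nu K M' \<pi>'"
  shows "map_pmf snd \<pi> = map_pmf snd \<pi>'"
proof -
  interpret A: stationary_station lam mu nu K M \<pi> by fact
  interpret B: stationary_station lam mu nu K M' \<pi>' by fact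
  show ?thesis
    by (rule pmf_nat_eqI_detailed_balance[OF A.total_balance B.total_balance])
       (use A.mu_pos in simp)
qed

lemma mean_total_unique:
  assumes "stationary_station lam mu nu K M \<pi>" "stationary_station lam mu nu K M' \<pi>'"
  shows "mean_total \<pi> = mean_total \<pi>'"
proof -
  have "mean_total p = measure_pmf.expectation (map_pmf snd p) real" for p
    by (simp add: mean_total_def case_prod_unfold)
  then show ?thesis by (simp only: law_of_total_unique[OF assms])
qed

section \<open>The Poisson equation of the infinite station\<close>

context stationary_station
begin

text \<open>
  The inhomogeneous term of the recursion for \<open>e\<close> when the constant \<open>a\<close> is the mean power: the
  function \<open>\<lambda> m - a d\<close>.
\<close>
definition surplus :: "nat \<Rightarrow> real" where
  "surplus u = lam * charging_power u - mean_power * loss_rate u"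

lemma surplus_0 [simp]: "surplus 0 = 0"
  by (simp add: surplus_def)

text \<open>
  Divided by \<open>u\<close>, the surplus is \<open>(\<lambda> - a \<nu>) m u / u - a \<mu>\<close>. The factor \<open>\<lambda> - a \<nu>\<close> is nonnegative by
  the throughput balance, and \<open>m u / u\<close>, the charging rate of a single EV, does not
  increase with \<open>u\<close>.
\<close>
lemma surplus_single_crossing:
  assumes "surplus i < 0" "i \<le> j"
  shows "surplus j < 0"
proof -
  have i: "0 < real i" using assms(1) by (cases i) auto
  have "accept_prob \<le> E (\<lambda>_. 1)"
    unfolding accept_prob_def by (intro integral_mono integrable_accept) auto
  then have "lam * accept_prob \<le> lam" using lam_pos by simp
  moreover have "0 \<le> mu * E (\<lambda>x. real (fst x))" using mu_pos by simp
  ultimately have slope: "0 \<le> lam - mean_power * nu"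
    using throughput_balance by (simp add: mult.commute)
  have "charging_power j * real i \<le> charging_power i * real j"
    using assms(2) M_pos i by (auto simp: charging_power_def min_def mult_mono mult.commute
      intro: mult_left_mono)
  then have "(lam - mean_power * nu) * (charging_power j * real i) \<le> (lam - mean_power * nu) * (charging_power i * real j)"
    using slope by (rule mult_left_mono)
  then have "surplus j * real i \<le> surplus i * real j"
    by (simp add: surplus_def loss_rate_def algebra_simps)
  also have "\<dots> < 0" using assms i by (intro mult_neg_pos) auto
  finally show ?thesis using i by (simp add: mult_less_0_iff)
qed

lemma integrable_surplus: "integrable \<pi> (\<lambda>x. surplus (fst x))"
  unfolding surplus_def loss_rate_def
  using integrable_uncharged integrable_power by simp

definition partial_surplus :: "nat \<Rightarrow> real" where
  "partial_surplus n = E (\<lambda>x. indicator {..n} (fst x) * surplus (fst x))"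

lemma integrable_partial_surplus:
  "integrable \<pi> (\<lambda>x. indicator {..n} (fst x) * surplus (fst x))"
  by (rule Bochner_Integration.integrable_bound[OF integrable_surplus])
     (auto simp: indicator_def)

text \<open>
  The mean of the surplus is \<open>\<lambda> a - a E d(U) = 0\<close>, since without blocking EVs arrive at rate \<open>\<lambda>\<close>.
  So if a negative term occurs up to \<open>n\<close>, the sum up to \<open>n\<close> is minus a tail all of whose terms
  are negative.
\<close>
lemma partial_surplus_nonneg:
  assumes "K = \<infinity>"
  shows "partial_surplus n \<ge> 0"
proof (cases "\<forall>i\<le>n. surplus i \<ge> 0")
  case True
  then show ?thesis unfolding partial_surplus_def
    by (intro integral_nonneg_AE AE_pmfI) (auto simp: indicator_def)
next
  case False
  then obtain i where i: "i \<le> n" "surplus i < 0" by auto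
  have "E (\<lambda>x. surplus (fst x))
      = lam * mean_power - mean_power * (mu * E (\<lambda>x. real (fst x)) + nu * mean_power)"
    unfolding surplus_def loss_rate_def using integrable_uncharged integrable_power
    by (simp add: mean_power_def algebra_simps)
  then have "E (\<lambda>x. surplus (fst x)) = 0"
    unfolding throughput_balance accept_prob_infinite[OF assms] by simp
  moreover have "E (\<lambda>x. surplus (fst x)) \<le> partial_surplus n"
    unfolding partial_surplus_def
  proof (intro integral_mono integrable_surplus integrable_partial_surplus)
    fix x :: "nat \<times> nat"
    show "surplus (fst x) \<le> indicator {..n} (fst x) * surplus (fst x)"
      using surplus_single_crossing[OF i(2), of "fst x"] i(1) by (auto simp: indicator_def)
  qed
  ultimately show ?thesis by simp
qed

lemma partial_surplus_Suc:
  "partial_surplus (Suc n) = partial_surplus n + pmf (map_pmf fst \<pi>) (Suc n) * surplus (Suc n)"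
proof -
  have "partial_surplus (Suc n) = E (\<lambda>x. indicator {..n} (fst x) * surplus (fst x)
      + indicator {Suc n} (fst x) * surplus (Suc n))"
    unfolding partial_surplus_def by (rule E_cong) (auto simp: indicator_def)
  also have "\<dots> = partial_surplus n + pmf (map_pmf fst \<pi>) (Suc n) * surplus (Suc n)"
    unfolding partial_surplus_def pmf_marginal
    by (subst Bochner_Integration.integral_add[OF integrable_partial_surplus])
       (auto intro!: integrable_mult_left integrable_bounded[of _ 1])
  finally show ?thesis .
qed

lemma pmf_uncharged_pos:
  assumes "K = \<infinity>"
  shows "pmf (map_pmf fst \<pi>) n > 0"
proof -
  have loss: "loss_rate (Suc n) > 0" for n
    using mu_pos nu_pos charging_power_bounds(1)[of "Suc n"]
    by (simp add: loss_rate_def add_pos_nonneg)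
  have 0: "pmf (map_pmf fst \<pi>) 0 \<noteq> 0"
  proof
    assume 0: "pmf (map_pmf fst \<pi>) 0 = 0"
    have "pmf (map_pmf fst \<pi>) n = 0" for n
    proof (induction n)
      case (Suc n)
      then show ?case using uncharged_balance[OF assms, of n] loss[of n] by simp
    qed (fact 0)
    moreover obtain n where "n \<in> set_pmf (map_pmf fst \<pi>)"
      using set_pmf_not_empty[of "map_pmf fst \<pi>"] by (metis ex_in_conv)
    ultimately show False by (simp only: set_pmf_iff)
  qed
  have "pmf (map_pmf fst \<pi>) n \<noteq> 0"
  proof (induction n)
    case (Suc n)
    then show ?case using uncharged_balance[OF assms, of n] lam_pos by auto
  qed (fact 0)
  then show ?thesis by (simp add: less_le)
qed

text \<open>
  The increment of \<open>G\<close> at \<open>u\<close> is \<open>(e u - a) / \<lambda>\<close>, and the Poisson equation turns into the recursion for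
  \<open>e\<close>. By the cut equations of \<open>U\<close> the partial surplus divided by \<open>\<lambda> p u\<close> solves it.
\<close>
lemma nonneg_correction_exists:
  assumes "K = \<infinity>"
  obtains e where "\<And>u. e u \<ge> 0" "e 0 = 0"
    "\<And>u. lam * e (Suc u) = loss_rate (Suc u) * e u + surplus (Suc u)"
proof
  let ?p = "pmf (map_pmf fst \<pi>)"
  define e where "e u = partial_surplus u / (lam * ?p u)" for u
  have p: "?p u > 0" for u by (rule pmf_uncharged_pos[OF assms])
  show "e u \<ge> 0" for u
    using partial_surplus_nonneg[OF assms] lam_pos by (simp add: e_def)
  have "partial_surplus 0 = E (\<lambda>_. 0)"
    unfolding partial_surplus_def
  proof (rule E_cong)
    fix u q
    show "indicator {..0} (fst (u, q)) * surplus (fst (u, q)) = 0"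
      by (cases "u = 0") (auto simp: indicator_def)
  qed
  then show "e 0 = 0" by (simp add: e_def)
  show "lam * e (Suc u) = loss_rate (Suc u) * e u + surplus (Suc u)" for u
  proof -
    have "?p (Suc u) * (lam * e (Suc u)) = partial_surplus (Suc u)"
      using p[of "Suc u"] lam_pos by (simp add: e_def)
    also have "\<dots> = lam * ?p u * e u + ?p (Suc u) * surplus (Suc u)"
      using p[of u] lam_pos by (simp add: partial_surplus_Suc e_def)
    also have "\<dots> = ?p (Suc u) * (loss_rate (Suc u) * e u + surplus (Suc u))"
      unfolding uncharged_balance[OF assms] by (simp add: algebra_simps)
    finally show ?thesis using p[of "Suc u"] by simp
  qed
qed

text \<open>
  Here \<open>\<pi>\<close> belongs to the finite station, while \<open>a\<close> and \<open>e\<close> come from the infinite one with the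
  same power capacity. The equation for \<open>G\<close> loses the term \<open>\<lambda> (G (u + 1) - G u) = e u - a\<close> in
  the states that block arrivals, and this loss has a favourable sign up to the constant \<open>a\<close>.
\<close>
lemma mean_power_ge_accept_prob:
  assumes K: "K = enat k"
    and e: "\<And>u. e u \<ge> 0" "e 0 = 0"
    and rec: "\<And>u. lam * e (Suc u) = loss_rate (Suc u) * e u + (lam * charging_power (Suc u) - a * loss_rate (Suc u))"
  shows "a * accept_prob \<le> mean_power"
proof -
  define G where "G u = (\<Sum>i<u. (e i - a) / lam)" for u
  have G: "lam * (G (Suc u) - G u) = e u - a" for u
    using lam_pos by (simp add: G_def)
  have G_bound: "\<bar>G (Suc n) - G n\<bar> \<le> (\<Sum>i<k. \<bar>(e i - a) / lam\<bar>)" if "enat n < K" for n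
    using that member_le_sum[of n "{..<k}" "\<lambda>i. \<bar>(e i - a) / lam\<bar>"] K by (simp add: G_def)
  have finite_support: "finite (set_pmf \<pi>)"
    by (rule finite_subset[of _ "{..k} \<times> {..k}"]) (use support K in \<open>force simp: ev_states_def\<close>)+
  have "0 = E (\<lambda>(u, q). (if enat q < K then lam * (G (Suc u) - G u) else 0)
      + loss_rate u * (G (u - 1) - G u))"
    by (rule mean_drift_uncharged[of G, symmetric]) (rule G_bound)
  also have "\<dots> = E (\<lambda>x. charging_power (fst x) - a * of_bool (enat (snd x) < K)
      - of_bool (\<not> enat (snd x) < K) * e (fst x))"
  proof (rule E_cong)
    fix u q
    have "loss_rate u * (G (u - 1) - G u) = charging_power u - e u"
    proof (cases u)
      case (Suc v)
      have "lam * (loss_rate u * (G (u - 1) - G u)) = - loss_rate u * (lam * (G (Suc v) - G v))"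
        by (simp add: Suc algebra_simps)
      also have "\<dots> = lam * (charging_power u - e u)"
        unfolding G using rec[of v] by (simp add: Suc algebra_simps)
      finally show ?thesis using lam_pos by simp
    qed (simp add: e)
    then show "(case (u, q) of (u, q) \<Rightarrow> (if enat q < K then lam * (G (Suc u) - G u) else 0)
      + loss_rate u * (G (u - 1) - G u)) = charging_power (fst (u, q)) - a * of_bool (enat (snd (u, q)) < K)
      - of_bool (\<not> enat (snd (u, q)) < K) * e (fst (u, q))"
      by (simp add: G)
  qed
  also have "\<dots> = mean_power - a * accept_prob - E (\<lambda>x. of_bool (\<not> enat (snd x) < K) * e (fst x))"
    by (simp add: mean_power_def accept_prob_def integrable_measure_pmf_finite[OF finite_support])
  also have "\<dots> \<le> mean_power - a * accept_prob"
    using e(1) by simp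
  finally show ?thesis by simp
qed

end

section \<open>Comparison of the charged fractions\<close>

theorem proposition3p1:
  fixes lam mu nu M :: real and K :: nat
    and pi_inf_M pi_K_M pi_K_K :: "(nat \<times> nat) pmf"
  assumes "lam > 0" and "mu > 0" and "nu > 0"
    and "K \<ge> 1" and "0 < M" and "M \<le> real K"
    and "ev_stationary lam mu nu \<infinity> M pi_inf_M"
    and "ev_stationary lam mu nu (enat K) M pi_K_M"
    and "ev_stationary lam mu nu (enat K) (real K) pi_K_K"
  shows "mean_charged pi_inf_M / mean_total pi_inf_M \<le> mean_charged pi_K_M / mean_total pi_K_M \<and>
         mean_charged pi_K_M / mean_total pi_K_M \<le> mean_charged pi_K_K / mean_total pi_K_M"
proof
  have K: "enat K > 0" using \<open>K \<ge> 1\<close> by (simp add: zero_enat_def)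
  interpret inf: stationary_station lam mu nu \<infinity> M pi_inf_M
    using assms by unfold_locales auto
  interpret fin: stationary_station lam mu nu "enat K" M pi_K_M
    using assms K by unfold_locales auto
  interpret full: stationary_station lam mu nu "enat K" "real K" pi_K_K
    using assms K by unfold_locales auto

  obtain e where e: "\<And>u. e u \<ge> 0" "e 0 = 0"
    "\<And>u. lam * e (Suc u) = inf.loss_rate (Suc u) * e u + inf.surplus (Suc u)"
    using inf.nonneg_correction_exists by blast
  have "inf.mean_power * fin.accept_prob \<le> fin.mean_power"
    by (rule fin.mean_power_ge_accept_prob[where e = e]) (use e in \<open>simp_all add: inf.surplus_def\<close>)
  then have "inf.mean_power / inf.accept_prob \<le> fin.mean_power / fin.accept_prob"
    using fin.accept_prob_pos by (simp add: inf.accept_prob_infinite field_simps)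
  then show "mean_charged pi_inf_M / mean_total pi_inf_M \<le> mean_charged pi_K_M / mean_total pi_K_M"
    unfolding inf.charged_fraction_eq fin.charged_fraction_eq
    using assms by (intro mult_left_mono) auto

  have "(mu + nu) * mean_charged pi_K_M \<le> nu * mean_total pi_K_M"
    by (rule fin.mean_charged_le)
  also have "mean_total pi_K_M = mean_total pi_K_K"
    by (rule mean_total_unique[OF fin.stationary_station_axioms full.stationary_station_axioms])
  also have "nu * mean_total pi_K_K = (mu + nu) * mean_charged pi_K_K"
    by (rule full.mean_charged_full_power[symmetric]) simp
  finally have "mean_charged pi_K_M \<le> mean_charged pi_K_K"
    using assms by simp
  then show "mean_charged pi_K_M / mean_total pi_K_M \<le> mean_charged pi_K_K / mean_total pi_K_M"
    using fin.mean_total_pos by (simp add: divide_right_mono)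
qed

end
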